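(* Let $M$ be a multiset with $|M|\geq 2$. There exists an involution $\Phi:\mathcal{T}_M\to\mathcal{T}_M$ such that for every $T\in\mathcal{T}_M$, $$(\mathsf{sleaf},\mathsf{eleaf},\mathsf{yleaf},\mathsf{yint})(T)=(\mathsf{eleaf},\mathsf{sleaf},\mathsf{yint},\mathsf{yleaf})(\Phi(T)).$$
   Context: A plane tree is a rooted tree in which the children of each node are linearly ordered (from left to right). $M=\{1^{p_1},2^{p_2},\ldots,n^{p_n}\}$ is a multiset in which $i$ has multiplicity $p_i$ ($n\ge1$, all $p_i\ge1$), with cardinality $|M|=p_1+\cdots+p_n$. A weakly increasing tree on $M$ is a plane tree with $|M|+1$ nodes that are labeled precisely by all elements of the multiset $M\cup\{0\}$ such that (i) the labels along a path from the root to any leaf are weakly increasing; (ii) the labels of the children of each node are weakly increasing from right to left. $\mathcal{T}_M$ is the set of weakly increasing trees on $M$. A leaf is a node without children; an internal node is a node with at least one child. A leaf is an old leaf if it is the leftmost child of its parent, and a young leaf otherwise. An old leaf is a singleton leaf if it is the only child of its parent, and an elder leaf if it has siblings. An internal node is an elder internal node if it is the parent of an elder leaf, a singleton internal node if it is the parent of a singleton leaf, and a young internal node otherwise. $\mathsf{sleaf}(T)$, $\mathsf{eleaf}(T)$, $\mathsf{yleaf}(T)$, $\mathsf{yint}(T)$ denote the numbers of singleton leaves, elder leaves, young leaves and young internal nodes of $T$, respectively. *)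

theory Defs
  imports Main "HOL-Library.Multiset" "HOL-Library.FuncSet"
begin

text \<open>Children are listed from left to right, so equality of terms is equality of labeled plane trees.\<close>

datatype ltree = Node (label: nat) (children: "ltree list")

text \<open>
  Since labels may repeat, a node is identified by its position: the list of child indices leading
  to it from the root, where index \<open>0\<close> is the leftmost child. Thus \<open>[]\<close> is the root and the parent
  of the node \<open>u @ [i]\<close> is \<open>u\<close>.
\<close>

primrec is_node :: "ltree \<Rightarrow> nat list \<Rightarrow> bool" where
  "is_node T [] \<longleftrightarrow> True"
| "is_node T (i # v) \<longleftrightarrow> i < length (children T) \<and> is_node (children T ! i) v"

definition nodes :: "ltree \<Rightarrow> nat list set" where
  "nodes T = {v. is_node T v}"

lemma finite_nodes [simp]: "finite (nodes T)"
proof (induction T)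
  case (Node a ts)
  have "nodes (Node a ts) \<subseteq> insert [] (\<Union>i<length ts. (#) i ` nodes (ts ! i))"
  proof
    fix v assume "v \<in> nodes (Node a ts)"
    then show "v \<in> insert [] (\<Union>i<length ts. (#) i ` nodes (ts ! i))"
      by (cases v) (auto simp: nodes_def)
  qed
  moreover have "finite (nodes (ts ! i))" if "i < length ts" for i
    using Node.IH that by simp
  ultimately show ?case
    by (auto intro: finite_subset)
qed

text \<open>\<open>subtree T v\<close> and what is built on it are meaningful only for \<open>v \<in> nodes T\<close>.\<close>

primrec subtree :: "ltree \<Rightarrow> nat list \<Rightarrow> ltree" where
  "subtree T [] = T"
| "subtree T (i # v) = subtree (children T ! i) v"

definition label_at :: "ltree \<Rightarrow> nat list \<Rightarrow> nat" where
  "label_at T v = label (subtree T v)"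

definition num_children :: "ltree \<Rightarrow> nat list \<Rightarrow> nat" where
  "num_children T v = length (children (subtree T v))"

definition leaf :: "ltree \<Rightarrow> nat list \<Rightarrow> bool" where
  "leaf T v \<longleftrightarrow> v \<in> nodes T \<and> num_children T v = 0"

definition internal_node :: "ltree \<Rightarrow> nat list \<Rightarrow> bool" where
  "internal_node T v \<longleftrightarrow> v \<in> nodes T \<and> num_children T v \<ge> 1"

definition node_labels :: "ltree \<Rightarrow> nat multiset" where
  "node_labels T = image_mset (label_at T) (mset_set (nodes T))"

definition path_labels :: "ltree \<Rightarrow> nat list \<Rightarrow> nat list" where
  "path_labels T v = map (\<lambda>k. label_at T (take k v)) [0..<Suc (length v)]"

text \<open>
  The equation for \<open>node_labels\<close> also fixes the number of nodes to be \<open>size M + 1\<close>.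
\<close>

definition weakly_increasing_tree :: "nat multiset \<Rightarrow> ltree \<Rightarrow> bool" where
  "weakly_increasing_tree M T \<longleftrightarrow>
     node_labels T = add_mset 0 M \<and>
     (\<forall>v. leaf T v \<longrightarrow> sorted (path_labels T v)) \<and>
     (\<forall>v\<in>nodes T. sorted (rev (map label (children (subtree T v)))))"

definition weakly_increasing_trees :: "nat multiset \<Rightarrow> ltree set" where
  "weakly_increasing_trees M = {T. weakly_increasing_tree M T}"

definition old_leaf :: "ltree \<Rightarrow> nat list \<Rightarrow> bool" where
  "old_leaf T v \<longleftrightarrow> leaf T v \<and> (\<exists>u. v = u @ [0])"

definition young_leaf :: "ltree \<Rightarrow> nat list \<Rightarrow> bool" where
  "young_leaf T v \<longleftrightarrow> leaf T v \<and> \<not> old_leaf T v"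

definition singleton_leaf :: "ltree \<Rightarrow> nat list \<Rightarrow> bool" where
  "singleton_leaf T v \<longleftrightarrow> old_leaf T v \<and> num_children T (butlast v) = 1"

definition elder_leaf :: "ltree \<Rightarrow> nat list \<Rightarrow> bool" where
  "elder_leaf T v \<longleftrightarrow> old_leaf T v \<and> num_children T (butlast v) \<ge> 2"

definition elder_internal :: "ltree \<Rightarrow> nat list \<Rightarrow> bool" where
  "elder_internal T u \<longleftrightarrow> internal_node T u \<and> (\<exists>i. elder_leaf T (u @ [i]))"

definition singleton_internal :: "ltree \<Rightarrow> nat list \<Rightarrow> bool" where
  "singleton_internal T u \<longleftrightarrow> internal_node T u \<and> (\<exists>i. singleton_leaf T (u @ [i]))"

definition young_internal :: "ltree \<Rightarrow> nat list \<Rightarrow> bool" where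
  "young_internal T u \<longleftrightarrow>
     internal_node T u \<and> \<not> elder_internal T u \<and> \<not> singleton_internal T u"

definition sleaf :: "ltree \<Rightarrow> nat" where
  "sleaf T = card {v. singleton_leaf T v}"

definition eleaf :: "ltree \<Rightarrow> nat" where
  "eleaf T = card {v. elder_leaf T v}"

definition yleaf :: "ltree \<Rightarrow> nat" where
  "yleaf T = card {v. young_leaf T v}"

definition yint :: "ltree \<Rightarrow> nat" where
  "yint T = card {v. young_internal T v}"

end

theory Submission
  imports Defs "HOL-Library.Tree_Multiset"
begin

text \<open>Read the children of a node from right to left and link every node to its rightmost child and to
  its left neighbour among its siblings. This is the child-sibling correspondence: a plane tree
  becomes a root together with a binary tree \<open>b\<close> on the other nodes, where the left child in \<open>b\<close> is
  the rightmost child in the plane tree and the right child in \<open>b\<close> is the next sibling. Labels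
  increase weakly along both kinds of links precisely when the plane tree is weakly increasing, so
  weakly increasing trees correspond to binary heaps on \<open>M\<close> (\<open>weakly_increasing_tree_forest\<close>).

  Both links impose the same condition, so exchanging them at every node, which mirrors \<open>b\<close>, is an
  involution on the weakly increasing trees on \<open>M\<close>. It remains to read the statistics off \<open>b\<close>.
  An empty left subtree means that a node is a leaf, an empty right subtree that it is a leftmost child. Hence:

  \<^item> old leaves are the leaves of \<open>b\<close>; such a leaf is an elder leaf if it is a right child, and a
    singleton leaf if it is a left child or is all of \<open>b\<close>;
  \<^item> young leaves are the nodes of \<open>b\<close> with a right child only;
  \<^item> young internal nodes correspond to the nodes of \<open>b\<close> with a left child only, since an internal
    node is young exactly when its leftmost child is itself internal.

  The mirror image exchanges left with right in each of these descriptions. The assumption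
  \<open>size M \<ge> 2\<close> excludes two exceptional cases: for the empty binary tree the root itself is a young
  leaf, and in a binary tree with a single node that node is a singleton leaf without being a left
  child.\<close>

section \<open>Trees counted through the multiset of their subtrees\<close>

text \<open>Node labels and the tree statistics are all images or filters of this one multiset, so they
  inherit their recursion over the children from that of \<open>subtree_mset\<close>.\<close>

definition subtree_mset :: "ltree \<Rightarrow> ltree multiset" where
  "subtree_mset T = image_mset (subtree T) (mset_set (nodes T))"

lemma nodes_Node:
  "nodes (ltree.Node a ts) = insert [] (\<Union>i<length ts. (#) i ` nodes (ts ! i))"
proof (rule set_eqI)
  fix v
  show "v \<in> nodes (ltree.Node a ts) \<longleftrightarrow> v \<in> insert [] (\<Union>i<length ts. (#) i ` nodes (ts ! i))"
    by (cases v) (auto simp: nodes_def)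
qed

lemma image_mset_UN_disjoint:
  assumes "finite I" "\<And>i. i \<in> I \<Longrightarrow> finite (A i)"
    and "\<And>i j. i \<in> I \<Longrightarrow> j \<in> I \<Longrightarrow> i \<noteq> j \<Longrightarrow> A i \<inter> A j = {}"
  shows "image_mset f (mset_set (\<Union>i\<in>I. A i)) = (\<Sum>i\<in>I. image_mset f (mset_set (A i)))"
  using assms
proof (induction I rule: finite_induct)
  case (insert i I)
  have "A i \<inter> (\<Union>j\<in>I. A j) = {}" using insert.hyps insert.prems by blast
  then show ?case using insert by (simp add: mset_set_Union)
qed simp

lemma subtree_mset_Node:
  "subtree_mset (ltree.Node a ts) =
     add_mset (ltree.Node a ts) (\<Sum>t\<leftarrow>ts. subtree_mset t)"
proof -
  let ?T = "ltree.Node a ts"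
  have "image_mset (subtree ?T) (mset_set ((#) i ` nodes (ts ! i))) = subtree_mset (ts ! i)" for i
    by (simp add: subtree_mset_def image_mset_mset_set[symmetric] multiset.map_comp comp_def)
  then have "image_mset (subtree ?T) (mset_set (\<Union>i<length ts. (#) i ` nodes (ts ! i)))
      = (\<Sum>i<length ts. subtree_mset (ts ! i))"
    by (subst image_mset_UN_disjoint) auto
  also have "\<dots> = (\<Sum>t\<leftarrow>ts. subtree_mset t)"
    by (simp add: sum_list_sum_nth atLeast0LessThan)
  finally have "image_mset (subtree ?T) (mset_set (\<Union>i<length ts. (#) i ` nodes (ts ! i)))
      = (\<Sum>t\<leftarrow>ts. subtree_mset t)" .
  then show ?thesis
    unfolding subtree_mset_def[of ?T] nodes_Node by (subst mset_set.insert) auto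
qed

definition count_subtrees :: "(ltree \<Rightarrow> bool) \<Rightarrow> ltree \<Rightarrow> nat" where
  "count_subtrees P T = card {v \<in> nodes T. P (subtree T v)}"

lemma count_subtrees_Node:
  "count_subtrees P (ltree.Node a ts) =
     of_bool (P (ltree.Node a ts)) + (\<Sum>t\<leftarrow>ts. count_subtrees P t)"
proof -
  have *: "count_subtrees P T = size (filter_mset P (subtree_mset T))" for T
    by (simp add: count_subtrees_def subtree_mset_def filter_mset_image_mset filter_mset_mset_set)
  have "size (filter_mset P (\<Sum>t\<leftarrow>ts. subtree_mset t))
      = (\<Sum>t\<leftarrow>ts. size (filter_mset P (subtree_mset t)))"
    by (induction ts) auto
  then show ?thesis by (simp add: * subtree_mset_Node)
qed

lemma node_labels_Node:
  "node_labels (ltree.Node a ts) = add_mset a (\<Sum>t\<leftarrow>ts. node_labels t)"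
proof -
  have *: "node_labels T = image_mset label (subtree_mset T)" for T
    by (simp add: node_labels_def subtree_mset_def label_at_def[abs_def] multiset.map_comp comp_def)
  have "image_mset label (\<Sum>t\<leftarrow>ts. subtree_mset t)
      = (\<Sum>t\<leftarrow>ts. image_mset label (subtree_mset t))"
    by (induction ts) auto
  then show ?thesis by (simp add: * subtree_mset_Node)
qed

section \<open>The statistics as numbers of subtrees\<close>

text \<open>A node has at most one old leaf among its children. Counting the parents instead of the old leaves
  turns \<open>sleaf\<close>, \<open>eleaf\<close> and \<open>yint\<close> into counts of subtrees with a property of the subtree alone.\<close>

definition old_leaf_parent :: "ltree \<Rightarrow> bool" where
  "old_leaf_parent t \<longleftrightarrow> children t \<noteq> [] \<and> children (hd (children t)) = []"

lemma is_node_snoc: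
  "is_node T (u @ [i]) \<longleftrightarrow> is_node T u \<and> i < length (children (subtree T u))"
  by (induction u arbitrary: T) auto

lemma subtree_snoc: "subtree T (u @ [i]) = children (subtree T u) ! i"
  by (induction u arbitrary: T) auto

lemma old_leaf_snoc:
  "old_leaf T (u @ [i]) \<longleftrightarrow> i = 0 \<and> u \<in> nodes T \<and> old_leaf_parent (subtree T u)"
  by (auto simp: old_leaf_def leaf_def old_leaf_parent_def nodes_def is_node_snoc subtree_snoc
      num_children_def hd_conv_nth)

lemma card_old_leaves:
  "card {v. old_leaf T v \<and> Q (num_children T (butlast v))} =
     count_subtrees (\<lambda>t. old_leaf_parent t \<and> Q (length (children t))) T"
proof -
  let ?A = "{u \<in> nodes T. old_leaf_parent (subtree T u) \<and> Q (length (children (subtree T u)))}"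
  have "{v. old_leaf T v \<and> Q (num_children T (butlast v))} = (\<lambda>u. u @ [0]) ` ?A" (is "?L = _")
  proof (rule set_eqI)
    fix v
    show "v \<in> ?L \<longleftrightarrow> v \<in> (\<lambda>u. u @ [0]) ` ?A"
    proof (cases v rule: rev_cases)
      case Nil
      then show ?thesis by (auto simp: old_leaf_def)
    next
      case (snoc u i)
      then show ?thesis by (auto simp: old_leaf_snoc num_children_def)
    qed
  qed
  then show ?thesis
    by (simp add: count_subtrees_def card_image inj_on_def)
qed

lemma sleaf_eq: "sleaf T = count_subtrees (\<lambda>t. old_leaf_parent t \<and> length (children t) = 1) T"
  using card_old_leaves[where Q = "\<lambda>k. k = 1"] by (simp add: sleaf_def singleton_leaf_def)

lemma eleaf_eq: "eleaf T = count_subtrees (\<lambda>t. old_leaf_parent t \<and> length (children t) \<ge> 2) T"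
  using card_old_leaves[where Q = "\<lambda>k. k \<ge> 2"] by (simp add: eleaf_def elder_leaf_def)

lemma yint_eq: "yint T = count_subtrees (\<lambda>t. children t \<noteq> [] \<and> \<not> old_leaf_parent t) T"
proof -
  have "young_internal T u \<longleftrightarrow>
      u \<in> nodes T \<and> children (subtree T u) \<noteq> [] \<and> \<not> old_leaf_parent (subtree T u)" for u
    \<comment> \<open>These cases distinguish lists of length 0, 1 and at least 2.\<close>
    by (cases "children (subtree T u)" rule: remdups_adj.cases)
      (auto simp: young_internal_def elder_internal_def singleton_internal_def internal_node_def
        elder_leaf_def singleton_leaf_def old_leaf_snoc num_children_def old_leaf_parent_def)
  then show ?thesis by (simp add: yint_def count_subtrees_def)
qed

text \<open>Being a young leaf depends on the parent as well as on the subtree. Being a leaf does not, so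
  young leaves are obtained from all leaves by subtracting the old ones.\<close>

lemma leaves_eq: "count_subtrees (\<lambda>t. children t = []) T = yleaf T + sleaf T + eleaf T"
proof -
  let ?Y = "{v. young_leaf T v}" and ?S = "{v. singleton_leaf T v}" and ?E = "{v. elder_leaf T v}"
  have fin: "finite ?Y" "finite ?S" "finite ?E"
    by (rule finite_subset[OF _ finite_nodes[of T]];
        auto simp: young_leaf_def singleton_leaf_def elder_leaf_def old_leaf_def leaf_def)+
  have "1 \<le> num_children T (butlast v)" if "old_leaf T v" for v
    using that by (auto simp: old_leaf_def leaf_def nodes_def is_node_snoc num_children_def Suc_le_eq)
  then have "singleton_leaf T v \<or> elder_leaf T v" if "old_leaf T v" for v
    using that by (fastforce simp: singleton_leaf_def elder_leaf_def)
  then have "{v \<in> nodes T. children (subtree T v) = []} = ?Y \<union> ?S \<union> ?E"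
    by (auto simp: young_leaf_def singleton_leaf_def elder_leaf_def old_leaf_def leaf_def
        num_children_def)
  moreover have "?Y \<inter> ?S = {}" "(?Y \<union> ?S) \<inter> ?E = {}"
    by (auto simp: young_leaf_def singleton_leaf_def elder_leaf_def)
  ultimately show ?thesis
    using fin by (simp add: count_subtrees_def yleaf_def sleaf_def eleaf_def card_Un_disjoint)
qed

section \<open>Plane forests as binary trees\<close>

text \<open>The inverse of the child-sibling encoding. The right subtree holds the siblings to the left of
  the topmost node, so the topmost node is the rightmost tree of the forest.\<close>

primrec forest :: "nat tree \<Rightarrow> ltree list" where
  "forest Leaf = []"
| "forest \<langle>l, x, r\<rangle> = forest r @ [ltree.Node x (forest l)]"

lemma forest_eq_Nil_iff [simp]: "forest b = [] \<longleftrightarrow> b = Leaf"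
  by (cases b) auto

lemma forest_inject: "forest b = forest b' \<Longrightarrow> b = b'"
proof (induction b arbitrary: b')
  case Leaf
  then show ?case by (cases b') auto
next
  case (Node l x r)
  then show ?case by (cases b') auto
qed

text \<open>The rightmost tree of a nonempty forest determines the label and the left subtree, the remaining
  trees determine the right subtree; both parts are smaller forests.\<close>

lemma forest_surj: "\<exists>b. forest b = ts"
proof (induction "size_list size ts" arbitrary: ts rule: less_induct)
  case less
  show ?case
  proof (cases ts rule: rev_cases)
    case Nil
    then show ?thesis by (metis forest.simps(1))
  next
    case (snoc us t)
    obtain x cs where t: "t = ltree.Node x cs" by (cases t)
    obtain l r where "forest l = cs" "forest r = us"
      using less[of cs] less[of us] by (auto simp: snoc t)
    then have "forest \<langle>l, x, r\<rangle> = ts" by (simp add: snoc t)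
    then show ?thesis ..
  qed
qed

primrec count_nodes :: "('a tree \<Rightarrow> 'a tree \<Rightarrow> bool) \<Rightarrow> 'a tree \<Rightarrow> nat" where
  "count_nodes P Leaf = 0"
| "count_nodes P \<langle>l, x, r\<rangle> = of_bool (P l r) + count_nodes P l + count_nodes P r"

lemma count_nodes_mirror:
  "count_nodes P (mirror b) = count_nodes (\<lambda>l r. P (mirror r) (mirror l)) b"
  by (induction b) auto

lemma size_eq_1_iff: "size b = 1 \<longleftrightarrow> (\<exists>t. forest b = [t] \<and> children t = [])"
  by (cases b) auto

text \<open>In this and the next two lemmas the root \<open>c\<close> is the parent of the whole forest. Adding a tree at
  the right end of a nonempty forest leaves the leftmost tree of the forest unchanged; hence for
  \<open>r \<noteq> Leaf\<close> the root keeps its contribution to \<open>yint\<close>. For \<open>r = Leaf\<close> the new tree is the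
  leftmost one, and the root counts iff it is not a leaf, that is, iff \<open>l \<noteq> Leaf\<close>.\<close>

lemma yint_forest:
  "yint (ltree.Node c (forest b)) = count_nodes (\<lambda>l r. l \<noteq> Leaf \<and> r = Leaf) b"
proof (induction b arbitrary: c)
  case Leaf
  then show ?case by (simp add: yint_eq count_subtrees_Node)
next
  case (Node l x r)
  show ?case
    using Node.IH(1)[of x] Node.IH(2)[of c]
    by (cases "r = Leaf")
      (auto simp: yint_eq count_subtrees_Node old_leaf_parent_def)
qed

text \<open>The root becomes the parent of an elder leaf at the moment when a forest consisting of a single
  leaf, that is \<open>size r = 1\<close>, receives a second tree.\<close>

lemma eleaf_forest:
  "eleaf (ltree.Node c (forest b)) = count_nodes (\<lambda>l r. size r = 1) b"
proof (induction b arbitrary: c)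
  case Leaf
  then show ?case by (simp add: eleaf_eq count_subtrees_Node old_leaf_parent_def)
next
  case (Node l x r)
  show ?case
    using Node.IH(1)[of x] Node.IH(2)[of c]
    unfolding forest.simps count_nodes.simps size_eq_1_iff eleaf_eq
    \<comment> \<open>These cases distinguish lists of length 0, 1 and at least 2.\<close>
    by (cases "forest r" rule: remdups_adj.cases)
      (auto simp: count_subtrees_Node old_leaf_parent_def neq_Nil_conv)
qed

text \<open>A nonroot node is the parent of a singleton leaf iff its left subtree has a single node. The
  first summand accounts for the root of the plane tree, which is not a node of \<open>b\<close>.\<close>

lemma sleaf_forest:
  "sleaf (ltree.Node c (forest b)) = of_bool (size b = 1) + count_nodes (\<lambda>l r. size l = 1) b"
proof (induction b arbitrary: c)
  case Leaf
  then show ?case by (simp add: sleaf_eq count_subtrees_Node old_leaf_parent_def)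
next
  case (Node l x r)
  show ?case
    using Node.IH(1)[of x] Node.IH(2)[of c]
    unfolding forest.simps count_nodes.simps size_eq_1_iff sleaf_eq
    \<comment> \<open>These cases distinguish lists of length 0, 1 and at least 2.\<close>
    by (cases "forest r" rule: remdups_adj.cases)
      (auto simp: count_subtrees_Node old_leaf_parent_def neq_Nil_conv)
qed

text \<open>Leaves of the forest are the nodes of \<open>b\<close> without a left child. Those that also lack a right child
  are the leaves of \<open>b\<close>; each of them is all of \<open>b\<close>, a left child or a right child, and so is
  counted once in \<open>sleaf\<close> or \<open>eleaf\<close>. What remains are the young leaves. For \<open>b = Leaf\<close> the root itself
  would be a young leaf.\<close>

lemma yleaf_forest:
  assumes "b \<noteq> Leaf"
  shows "yleaf (ltree.Node c (forest b)) = count_nodes (\<lambda>l r. l = Leaf \<and> r \<noteq> Leaf) b"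
proof -
  let ?c = "\<lambda>t. children t = []"
  have "count_subtrees ?c (ltree.Node c (forest b)) =
      of_bool (b = Leaf) + count_nodes (\<lambda>l r. l = Leaf) b" for c
  proof (induction b arbitrary: c)
    case (Node l x r)
    show ?case
      using Node.IH(1)[of x] Node.IH(2)[of c] by (auto simp: count_subtrees_Node)
  qed (simp add: count_subtrees_Node)
  moreover have "count_nodes (\<lambda>l r. l = Leaf) b =
      count_nodes (\<lambda>l r. l = Leaf \<and> r \<noteq> Leaf) b + of_bool (size b = 1) +
      count_nodes (\<lambda>l r. size l = 1) b + count_nodes (\<lambda>l r. size r = 1) b"
    by (induction b) auto
  ultimately show ?thesis
    using assms leaves_eq[of "ltree.Node c (forest b)"] by (simp add: sleaf_forest eleaf_forest)
qed

section \<open>Weakly increasing trees as heaps\<close>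

definition children_weakly_increasing :: "ltree \<Rightarrow> bool" where
  "children_weakly_increasing T \<longleftrightarrow>
     (\<forall>v\<in>nodes T. sorted (rev (map label (children (subtree T v)))))"

definition paths_weakly_increasing :: "ltree \<Rightarrow> bool" where
  "paths_weakly_increasing T \<longleftrightarrow> (\<forall>v. leaf T v \<longrightarrow> sorted (path_labels T v))"

lemma children_weakly_increasing_Node:
  "children_weakly_increasing (ltree.Node a ts) \<longleftrightarrow>
     sorted (rev (map label ts)) \<and> (\<forall>t\<in>set ts. children_weakly_increasing t)"
  unfolding children_weakly_increasing_def nodes_Node by (fastforce simp: in_set_conv_nth)

lemma leaf_Cons: "leaf T (i # v) \<longleftrightarrow> i < length (children T) \<and> leaf (children T ! i) v"
  by (auto simp: leaf_def nodes_def num_children_def)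

lemma leaf_Nil: "leaf T [] \<longleftrightarrow> children T = []"
  by (auto simp: leaf_def nodes_def num_children_def)

lemma ex_leaf: "\<exists>v. leaf T v"
proof (induction T)
  case (Node a ts)
  show ?case
  proof (cases ts)
    case Nil
    then have "leaf (ltree.Node a ts) []" by (simp add: leaf_Nil)
    then show ?thesis ..
  next
    case (Cons t us)
    then obtain v where "leaf t v" using Node by auto
    then have "leaf (ltree.Node a ts) (0 # v)" by (simp add: leaf_Cons Cons)
    then show ?thesis ..
  qed
qed

lemma path_labels_Nil: "path_labels T [] = [label T]"
  by (simp add: path_labels_def label_at_def)

lemma path_labels_Cons: "path_labels T (i # v) = label T # path_labels (children T ! i) v"
proof -
  have "[0..<Suc (length (i # v))] = 0 # map Suc [0..<Suc (length v)]"
    by (simp add: map_Suc_upt upt_conv_Cons del: upt_Suc)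
  then show ?thesis by (simp add: path_labels_def label_at_def comp_def del: upt_Suc)
qed

lemma sorted_Cons_path_labels:
  "sorted (a # path_labels T v) \<longleftrightarrow> a \<le> label T \<and> sorted (path_labels T v)"
  by (cases v) (auto simp: path_labels_Nil path_labels_Cons)

text \<open>The condition on root-to-leaf paths amounts to comparing each node with its children, since every
  child lies on the path to some leaf (\<open>ex_leaf\<close>).\<close>

lemma paths_weakly_increasing_Node:
  "paths_weakly_increasing (ltree.Node a ts) \<longleftrightarrow>
     (\<forall>t\<in>set ts. a \<le> label t \<and> paths_weakly_increasing t)"
proof
  assume L: "paths_weakly_increasing (ltree.Node a ts)"
  show "\<forall>t\<in>set ts. a \<le> label t \<and> paths_weakly_increasing t"
  proof
    fix t assume "t \<in> set ts"
    then obtain i where i: "i < length ts" "ts ! i = t" by (auto simp: in_set_conv_nth)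
    have "sorted (a # path_labels t v)" if "leaf t v" for v
      using L that i unfolding paths_weakly_increasing_def
      by (auto dest: spec[of _ "i # v"] simp: leaf_Cons path_labels_Cons)
    then show "a \<le> label t \<and> paths_weakly_increasing t"
      using ex_leaf[of t] unfolding paths_weakly_increasing_def sorted_Cons_path_labels by blast
  qed
next
  assume R: "\<forall>t\<in>set ts. a \<le> label t \<and> paths_weakly_increasing t"
  have "sorted (path_labels (ltree.Node a ts) v)" if "leaf (ltree.Node a ts) v" for v
  proof (cases v)
    case Nil
    then show ?thesis by (simp add: path_labels_Nil)
  next
    case (Cons i w)
    then have "ts ! i \<in> set ts" "leaf (ts ! i) w" using that by (auto simp: leaf_Cons)
    then have "sorted (a # path_labels (ts ! i) w)"
      using R unfolding sorted_Cons_path_labels paths_weakly_increasing_def by blast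
    then show ?thesis by (simp add: Cons path_labels_Cons)
  qed
  then show "paths_weakly_increasing (ltree.Node a ts)"
    by (simp add: paths_weakly_increasing_def)
qed

lemma node_labels_forest: "node_labels (ltree.Node c (forest b)) = add_mset c (mset_tree b)"
  by (induction b arbitrary: c) (simp_all add: node_labels_Node)

text \<open>The topmost node \<open>x\<close> of \<open>b\<close> is the rightmost and hence smallest child of the root. The remaining
  children satisfy the conditions below the root \<open>c\<close> and are at least \<open>x\<close> exactly if they satisfy the
  conditions as children of \<open>x\<close>, given \<open>c \<le> x\<close>. Therefore both subtrees of \<open>b\<close> are subject to the same
  condition with the lower bound \<open>x\<close>. This symmetry between children and siblings is what makes the
  mirror image of a weakly increasing tree weakly increasing.\<close>

lemma weakly_increasing_forest:
  "paths_weakly_increasing (ltree.Node c (forest b)) \<and>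
     children_weakly_increasing (ltree.Node c (forest b)) \<longleftrightarrow>
   heap b \<and> (\<forall>x\<in>set_tree b. c \<le> x)"
proof (induction b arbitrary: c)
  case Leaf
  then show ?case by (simp add: paths_weakly_increasing_Node children_weakly_increasing_Node)
next
  case (Node l x r)
  have "paths_weakly_increasing (ltree.Node c (forest \<langle>l, x, r\<rangle>)) \<and>
      children_weakly_increasing (ltree.Node c (forest \<langle>l, x, r\<rangle>)) \<longleftrightarrow>
    c \<le> x \<and>
    (paths_weakly_increasing (ltree.Node x (forest l)) \<and>
      children_weakly_increasing (ltree.Node x (forest l))) \<and>
    (paths_weakly_increasing (ltree.Node x (forest r)) \<and>
      children_weakly_increasing (ltree.Node x (forest r)))"
    unfolding forest.simps paths_weakly_increasing_Node[of _ "_ @ _"]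
      children_weakly_increasing_Node[of _ "_ @ _"]
      paths_weakly_increasing_Node[of _ "forest r"]
      children_weakly_increasing_Node[of _ "forest r"]
    by (auto simp: sorted_append intro: order_trans)
  also have "\<dots> \<longleftrightarrow> heap \<langle>l, x, r\<rangle> \<and> (\<forall>y\<in>set_tree \<langle>l, x, r\<rangle>. c \<le> y)"
    unfolding Node.IH by (auto intro: order_trans)
  finally show ?case .
qed

lemma weakly_increasing_tree_forest:
  "weakly_increasing_tree M (ltree.Node c (forest b)) \<longleftrightarrow>
     add_mset c (mset_tree b) = add_mset 0 M \<and> heap b \<and> (\<forall>x\<in>set_tree b. c \<le> x)"
  using weakly_increasing_forest[of c b]
  unfolding weakly_increasing_tree_def node_labels_forest
    paths_weakly_increasing_def children_weakly_increasing_def by blast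

section \<open>The involution\<close>

definition mirror_forest :: "ltree \<Rightarrow> ltree" where
  "mirror_forest T = ltree.Node (label T) (forest (mirror (inv forest (children T))))"

lemma mirror_forest_Node:
  "mirror_forest (ltree.Node c (forest b)) = ltree.Node c (forest (mirror b))"
  by (simp add: mirror_forest_def inv_f_f inj_def forest_inject)

lemma ltree_cases_forest: obtains c b where "T = ltree.Node c (forest b)"
  by (metis forest_surj ltree.exhaust)

lemma mset_tree_mirror: "mset_tree (mirror b) = mset_tree b"
  by (rule Tree_Multiset.map_mirror)

lemma set_tree_mirror: "set_tree (mirror b) = set_tree b"
  by (metis mset_tree_mirror set_mset_tree)

lemma heap_mirror: "heap (mirror b) \<longleftrightarrow> heap b"
  by (induction b) (auto simp: set_tree_mirror)

lemma weakly_increasing_tree_mirror_forest: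
  "weakly_increasing_tree M (mirror_forest T) \<longleftrightarrow> weakly_increasing_tree M T"
  by (rule ltree_cases_forest[of T])
    (simp add: mirror_forest_Node weakly_increasing_tree_forest mset_tree_mirror set_tree_mirror
      heap_mirror)

lemma mirror_forest_mirror_forest: "mirror_forest (mirror_forest T) = T"
  by (rule ltree_cases_forest[of T]) (simp add: mirror_forest_Node)

lemma statistics_mirror_forest:
  assumes "weakly_increasing_tree M T" and "size M \<ge> 2"
  shows "(sleaf T, eleaf T, yleaf T, yint T) =
    (eleaf (mirror_forest T), sleaf (mirror_forest T),
     yint (mirror_forest T), yleaf (mirror_forest T))"
proof -
  obtain c b where T: "T = ltree.Node c (forest b)" by (rule ltree_cases_forest)
  have "size (add_mset c (mset_tree b)) = size (add_mset 0 M)"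
    using assms(1) by (simp only: T weakly_increasing_tree_forest)
  then have "size b \<ge> 2" using assms(2) by simp
  then have "b \<noteq> Leaf" "size b \<noteq> 1" by auto
  then show ?thesis
    by (simp add: T mirror_forest_Node sleaf_forest eleaf_forest yleaf_forest yint_forest
        count_nodes_mirror conj_commute)
qed

theorem theorem1p2:
  fixes n :: nat and M :: "nat multiset"
  assumes "n \<ge> 1" and "set_mset M = {1..n}" and "size M \<ge> 2"
  shows "\<exists>\<Phi>. \<Phi> \<in> weakly_increasing_trees M \<rightarrow> weakly_increasing_trees M \<and>
    (\<forall>T\<in>weakly_increasing_trees M. \<Phi> (\<Phi> T) = T) \<and>
    (\<forall>T\<in>weakly_increasing_trees M.
       (sleaf T, eleaf T, yleaf T, yint T) =
       (eleaf (\<Phi> T), sleaf (\<Phi> T), yint (\<Phi> T), yleaf (\<Phi> T)))"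
proof (intro exI conjI)
  show "mirror_forest \<in> weakly_increasing_trees M \<rightarrow> weakly_increasing_trees M"
    by (simp add: weakly_increasing_trees_def weakly_increasing_tree_mirror_forest)
  show "\<forall>T\<in>weakly_increasing_trees M. mirror_forest (mirror_forest T) = T"
    by (simp add: mirror_forest_mirror_forest)
  show "\<forall>T\<in>weakly_increasing_trees M. (sleaf T, eleaf T, yleaf T, yint T) =
       (eleaf (mirror_forest T), sleaf (mirror_forest T),
        yint (mirror_forest T), yleaf (mirror_forest T))"
    using statistics_mirror_forest assms(3) unfolding weakly_increasing_trees_def by blast
qed

end
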